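(* Let $0<\beta\le 1$, let $\mathcal N\subset\mathcal H\subset\mathcal N'$ be a nuclear triple, and let $\mu_\beta$ be the Mittag-Leffler measure on $(\mathcal N',\mathcal C_\sigma(\mathcal N'))$. Let $n\in\mathbb N$ and let $\{\varphi_1,\dots,\varphi_n\}$ be an orthonormal set (of $n$ elements) in $\mathcal H$. Then the random variables $\langle\cdot,\varphi_1\rangle,\dots,\langle\cdot,\varphi_n\rangle$ on the probability space $(\mathcal N',\mathcal C_\sigma(\mathcal N'),\mu_\beta)$ are independent if and only if $n=1$ or $\beta=1$.
   Context: Nuclear triple: $\mathcal H$ is a real separable Hilbert space with scalar product $(\cdot,\cdot)$ and norm $|\cdot|_0$; $\mathcal N$ is a nuclear Fréchet space topologically and densely embedded in $\mathcal H$, given as the projective limit of real separable Hilbert spaces $(\mathcal H_p)_{p\in\mathbb N}$ (with $\mathcal H_0=\mathcal H$) such that each inclusion $\mathcal H_{p+1}\subset\mathcal H_p$, $p\ge 0$, is Hilbert-Schmidt and $|\cdot|_p\le|\cdot|_{p+1}$ on $\mathcal H_{p+1}$; $\mathcal N'$ is its dual; the dual pairing $\langle\cdot,\cdot\rangle$ between $\mathcal N'$ and $\mathcal N$ extends the scalar product of $\mathcal H$. $\mathcal C_\sigma(\mathcal N')$ is the $\sigma$-algebra generated by the cylinder sets. Mittag-Leffler function: $E_\beta(z)=\sum_{n=0}^\infty \frac{z^n}{\Gamma(\beta n+1)}$, $z\in\mathbb C$. Mittag-Leffler measure: for $0<\beta\le 1$, $\mu_\beta$ is the unique probability measure on $(\mathcal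 N',\mathcal C_\sigma(\mathcal N'))$ with $\int_{\mathcal N'}e^{i\langle\omega,\varphi\rangle}\,d\mu_\beta(\omega)=E_\beta\left(-\tfrac12\langle\varphi,\varphi\rangle\right)$ for all $\varphi\in\mathcal N$. One has $\|\langle\cdot,\varphi\rangle\|_{L^2(\mu_\beta)}^2=\frac{1}{\Gamma(\beta+1)}|\varphi|_0^2$ for $\varphi\in\mathcal N$; for $\eta\in\mathcal H$, $\langle\cdot,\eta\rangle$ denotes the $L^2(\mu_\beta)$-limit of $\langle\cdot,\varphi_n\rangle$ for any sequence $(\varphi_n)$ in $\mathcal N$ converging to $\eta$ in $\mathcal H$. *)

theory Defs
  imports "HOL-Probability.Probability"
begin

section \<open>Hilbert spaces carried by a subset of a type\<close>

text \<open>The guard makes the distance symmetric and nonnegative on the whole type, as the locale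
  \<^locale>\<open>Metric_space\<close> demands; only its values on \<open>V\<close> matter.\<close>

definition ip_dist :: "'a::real_vector set \<Rightarrow> ('a \<Rightarrow> 'a \<Rightarrow> real) \<Rightarrow> 'a \<Rightarrow> 'a \<Rightarrow> real" where
  "ip_dist V ip x y = (if x \<in> V \<and> y \<in> V then sqrt (ip (x - y) (x - y)) else 0)"

definition ip_topology :: "'a::real_vector set \<Rightarrow> ('a \<Rightarrow> 'a \<Rightarrow> real) \<Rightarrow> 'a topology" where
  "ip_topology V ip = Metric_space.mtopology V (ip_dist V ip)"

locale inner_product_on =
  fixes V :: "'a::real_vector set" and ip :: "'a \<Rightarrow> 'a \<Rightarrow> real"
  assumes subspace_carrier: "subspace V"
    and ip_commute: "\<And>x y. x \<in> V \<Longrightarrow> y \<in> V \<Longrightarrow> ip x y = ip y x"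
    and ip_add_left: "\<And>x y z. x \<in> V \<Longrightarrow> y \<in> V \<Longrightarrow> z \<in> V \<Longrightarrow> ip (x + y) z = ip x z + ip y z"
    and ip_scaleR_left: "\<And>c x y. x \<in> V \<Longrightarrow> y \<in> V \<Longrightarrow> ip (c *\<^sub>R x) y = c * ip x y"
    and ip_nonneg: "\<And>x. x \<in> V \<Longrightarrow> 0 \<le> ip x x"
    and ip_definite: "\<And>x. x \<in> V \<Longrightarrow> ip x x = 0 \<Longrightarrow> x = 0"
begin

lemma ip_add_self:
  assumes x: "x \<in> V" and y: "y \<in> V"
  shows "ip (x + y) (x + y) = ip x x + 2 * ip x y + ip y y"
proof -
  have xy: "x + y \<in> V"
    using subspace_carrier x y by (rule subspace_add)
  have "ip (x + y) (x + y) = ip x (x + y) + ip y (x + y)"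
    using x y xy by (rule ip_add_left)
  also have "ip x (x + y) = ip x x + ip y x"
    using ip_commute[OF x xy] ip_add_left[OF x y x] by (rule trans)
  also have "ip y (x + y) = ip x y + ip y y"
    using ip_commute[OF y xy] ip_add_left[OF x y y] by (rule trans)
  also have "ip y x = ip x y"
    using y x by (rule ip_commute)
  finally show ?thesis by simp
qed

lemma cauchy_schwarz:
  assumes x: "x \<in> V" and y: "y \<in> V"
  shows "(ip x y)\<^sup>2 \<le> ip x x * ip y y"
proof (cases "y = 0")
  case True
  have "ip y x = 0"
    using ip_scaleR_left[of y x 0] x y True by simp
  then show ?thesis
    using ip_commute[OF x y] ip_nonneg[OF x] ip_nonneg[OF y] by simp
next
  case False
  define b where "b = ip y y"
  define a where "a = ip x y"
  have b: "b > 0"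
    using ip_nonneg[OF y] ip_definite[OF y] False unfolding b_def by fastforce
  have ry: "c *\<^sub>R y \<in> V" for c
    using subspace_carrier y by (simp add: subspace_scale)
  have w: "x + c *\<^sub>R y \<in> V" for c
    using subspace_carrier x ry by (simp add: subspace_add)
  have exp: "ip (x + c *\<^sub>R y) (x + c *\<^sub>R y) = ip x x + 2 * c * a + c\<^sup>2 * b" for c
  proof -
    have "ip x (c *\<^sub>R y) = c * a"
      unfolding a_def ip_commute[OF x ry] ip_commute[OF x y] by (rule ip_scaleR_left[OF y x])
    moreover have "ip (c *\<^sub>R y) (c *\<^sub>R y) = c * (c * b)"
      unfolding b_def ip_scaleR_left[OF y ry] ip_commute[OF y ry] ip_scaleR_left[OF y y] ..
    ultimately show ?thesis
      unfolding ip_add_self[OF x ry] power2_eq_square by (simp only: mult.assoc)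
  qed
  have "0 \<le> ip x x + 2 * (- a / b) * a + (- a / b)\<^sup>2 * b"
    using ip_nonneg[OF w] exp by metis
  also have "\<dots> = ip x x - a\<^sup>2 / b"
    using b by (simp add: power2_eq_square field_simps)
  finally show ?thesis
    using b by (simp add: a_def b_def field_simps)
qed

lemma Metric_space_ip: "Metric_space V (ip_dist V ip)"
proof
  have sub: "x - y \<in> V" if "x \<in> V" "y \<in> V" for x y
    using subspace_carrier that by (simp add: subspace_diff)
  show "0 \<le> ip_dist V ip x y" for x y
    unfolding ip_dist_def using ip_nonneg sub by simp
  show "ip_dist V ip x y = ip_dist V ip y x" for x y
  proof (cases "x \<in> V \<and> y \<in> V")
    case True
    then have d: "x - y \<in> V" "y - x \<in> V" using sub by auto
    have "ip (y - x) (y - x) = - ip (x - y) (y - x)"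
      using ip_scaleR_left[OF d, of "-1"] by simp
    also have "\<dots> = ip (x - y) (x - y)"
      using ip_scaleR_left[OF d(1) d(1), of "-1"] ip_commute[OF d] by simp
    finally show ?thesis using True by (simp add: ip_dist_def)
  qed (auto simp: ip_dist_def)
  show "(ip_dist V ip x y = 0) = (x = y)" if "x \<in> V" "y \<in> V" for x y
    using that sub[OF that] ip_definite[of "x - y"] ip_scaleR_left[of 0 0 0]
      subspace_0[OF subspace_carrier]
    by (auto simp: ip_dist_def)
  show "ip_dist V ip x z \<le> ip_dist V ip x y + ip_dist V ip y z"
    if xyz: "x \<in> V" "y \<in> V" "z \<in> V" for x y z
  proof -
    define u where "u = x - y"
    define v where "v = y - z"
    have uv: "u \<in> V" "v \<in> V" "u + v \<in> V"
      using xyz sub subspace_add[OF subspace_carrier] by (auto simp: u_def v_def)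
    have xz: "x - z = u + v" by (simp add: u_def v_def)
    have "ip (u + v) (u + v) = ip u u + 2 * ip u v + ip v v"
      by (rule ip_add_self[OF uv(1,2)])
    also have "ip u v \<le> sqrt (ip u u) * sqrt (ip v v)"
      using cauchy_schwarz[OF uv(1,2)] by (simp add: real_le_rsqrt flip: real_sqrt_mult)
    finally have "ip (u + v) (u + v) \<le> (sqrt (ip u u) + sqrt (ip v v))\<^sup>2"
      using ip_nonneg[OF uv(1)] ip_nonneg[OF uv(2)] by (simp add: power2_sum)
    then have "sqrt (ip (u + v) (u + v)) \<le> sqrt (ip u u) + sqrt (ip v v)"
      using ip_nonneg[OF uv(1)] ip_nonneg[OF uv(2)] by (intro real_le_lsqrt) auto
    then show ?thesis
      using xyz by (simp add: ip_dist_def xz flip: u_def v_def)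
  qed
qed

end

locale separable_hilbert_on = inner_product_on +
  assumes complete: "Metric_space.mcomplete V (ip_dist V ip)"
    and separable: "separable_space (ip_topology V ip)"

definition orthonormal_basis_on :: "'a::real_vector set \<Rightarrow> ('a \<Rightarrow> 'a \<Rightarrow> real) \<Rightarrow> 'a set \<Rightarrow> bool" where
  "orthonormal_basis_on V ip B \<longleftrightarrow>
     B \<subseteq> V \<and> (\<forall>e\<in>B. \<forall>f\<in>B. ip e f = (if e = f then 1 else 0)) \<and>
     ip_topology V ip closure_of span B = V"

text \<open>The value of the sum does not depend on the orthonormal basis.\<close>

definition hilbert_schmidt_inclusion ::
  "'a::real_vector set \<Rightarrow> ('a \<Rightarrow> 'a \<Rightarrow> real) \<Rightarrow> 'a set \<Rightarrow> ('a \<Rightarrow> 'a \<Rightarrow> real) \<Rightarrow> bool" where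
  "hilbert_schmidt_inclusion V ipV W ipW \<longleftrightarrow>
     V \<subseteq> W \<and> (\<exists>B. orthonormal_basis_on V ipV B \<and> (\<lambda>e. ipW e e) summable_on B)"

section \<open>Nuclear triples\<close>

text \<open>The central space \<open>\<H>\<close> is the type \<open>'h\<close>; \<open>V p\<close> is the carrier of \<open>\<H>\<^sub>p\<close> and \<open>ip p\<close> its scalar
  product. For a decreasing sequence of spaces with the inclusions as connecting maps, the
  projective limit is the intersection with the initial topology.\<close>

definition nuclear_space :: "(nat \<Rightarrow> 'h set) \<Rightarrow> 'h set" where
  "nuclear_space V = (\<Inter>p. V p)"

definition nuclear_topology ::
  "(nat \<Rightarrow> 'h::real_vector set) \<Rightarrow> (nat \<Rightarrow> 'h \<Rightarrow> 'h \<Rightarrow> real) \<Rightarrow> 'h topology" where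
  "nuclear_topology V ip =
     topology_generated_by {U \<inter> nuclear_space V | p U. openin (ip_topology (V p) (ip p)) U}"

locale nuclear_triple =
  fixes V :: "nat \<Rightarrow> 'h::{real_inner, banach} set" and ip :: "nat \<Rightarrow> 'h \<Rightarrow> 'h \<Rightarrow> real"
  assumes V_0: "V 0 = UNIV" and ip_0: "ip 0 = inner"
    and hilbert: "\<And>p. separable_hilbert_on (V p) (ip p)"
    and hilbert_schmidt: "\<And>p. hilbert_schmidt_inclusion (V (Suc p)) (ip (Suc p)) (V p) (ip p)"
    and norm_mono: "\<And>p x. x \<in> V (Suc p) \<Longrightarrow> sqrt (ip p x x) \<le> sqrt (ip (Suc p) x x)"
    and dense: "closure (nuclear_space V) = UNIV"

text \<open>An element \<open>\<omega>\<close> of \<open>\<N>'\<close> is a functional on \<open>\<N>\<close>, made a unique function on \<open>'h\<close> by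
  extensionality. The dual pairing of \<open>\<omega>\<close> and \<open>\<phi>\<close> is \<open>\<omega> \<phi>\<close>, and \<open>\<eta>\<close> in \<open>\<H>\<close> is embedded into \<open>\<N>'\<close> as
  the restriction of \<open>inner \<eta>\<close> to \<open>\<N>\<close>.\<close>

definition nuclear_dual ::
  "(nat \<Rightarrow> 'h::real_vector set) \<Rightarrow> (nat \<Rightarrow> 'h \<Rightarrow> 'h \<Rightarrow> real) \<Rightarrow> ('h \<Rightarrow> real) set" where
  "nuclear_dual V ip =
     {\<omega> \<in> extensional (nuclear_space V).
        (\<forall>x\<in>nuclear_space V. \<forall>y\<in>nuclear_space V. \<omega> (x + y) = \<omega> x + \<omega> y) \<and>
        (\<forall>c. \<forall>x\<in>nuclear_space V. \<omega> (c *\<^sub>R x) = c * \<omega> x) \<and>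
        continuous_map (nuclear_topology V ip) euclideanreal \<omega>}"

definition cylinder_sets ::
  "(nat \<Rightarrow> 'h::real_vector set) \<Rightarrow> (nat \<Rightarrow> 'h \<Rightarrow> 'h \<Rightarrow> real) \<Rightarrow> ('h \<Rightarrow> real) set set" where
  "cylinder_sets V ip =
     {{\<omega> \<in> nuclear_dual V ip. (\<lambda>i\<in>{..<k}. \<omega> (\<phi> i)) \<in> A} | (k::nat) \<phi> A.
        (\<forall>i<k. \<phi> i \<in> nuclear_space V) \<and> A \<in> sets (Pi\<^sub>M {..<k} (\<lambda>_. borel))}"

section \<open>The Mittag-Leffler measure\<close>

definition mittag_leffler :: "real \<Rightarrow> complex \<Rightarrow> complex" where
  "mittag_leffler \<beta> z = (\<Sum>n. z ^ n / of_real (Gamma (\<beta> * real n + 1)))"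

definition is_mittag_leffler_measure ::
  "(nat \<Rightarrow> 'h::real_inner set) \<Rightarrow> (nat \<Rightarrow> 'h \<Rightarrow> 'h \<Rightarrow> real) \<Rightarrow> real \<Rightarrow> ('h \<Rightarrow> real) measure \<Rightarrow> bool" where
  "is_mittag_leffler_measure V ip \<beta> \<mu> \<longleftrightarrow>
     prob_space \<mu> \<and>
     space \<mu> = nuclear_dual V ip \<and>
     sets \<mu> = sigma_sets (nuclear_dual V ip) (cylinder_sets V ip) \<and>
     (\<forall>\<phi>\<in>nuclear_space V.
        (\<integral>\<omega>. exp (\<i> * of_real (\<omega> \<phi>)) \<partial>\<mu>) = mittag_leffler \<beta> (of_real (- (1/2) * inner \<phi> \<phi>)))"

definition L2_limit :: "'a measure \<Rightarrow> (nat \<Rightarrow> 'a \<Rightarrow> real) \<Rightarrow> ('a \<Rightarrow> real) \<Rightarrow> bool" where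
  "L2_limit M f X \<longleftrightarrow>
     X \<in> borel_measurable M \<and> integrable M (\<lambda>\<omega>. (X \<omega>)\<^sup>2) \<and>
     (\<lambda>k. \<integral>\<^sup>+ \<omega>. ennreal ((f k \<omega> - X \<omega>)\<^sup>2) \<partial>M) \<longlonglongrightarrow> 0"

text \<open>\<open>X\<close> is a version (representative of the \<open>L\<^sup>2\<close>-class) of the random variable
  \<open>\<langle>\<cdot>, \<eta>\<rangle>\<close>, for arbitrary \<open>\<eta>\<close> in \<open>\<H>\<close>.\<close>

definition is_L2_pairing ::
  "(nat \<Rightarrow> 'h::real_inner set) \<Rightarrow> ('h \<Rightarrow> real) measure \<Rightarrow> 'h \<Rightarrow> (('h \<Rightarrow> real) \<Rightarrow> real) \<Rightarrow> bool" where
  "is_L2_pairing V \<mu> \<eta> X \<longleftrightarrow>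
     (\<forall>\<psi>. (\<forall>k. \<psi> k \<in> nuclear_space V) \<and> \<psi> \<longlonglongrightarrow> \<eta> \<longrightarrow> L2_limit \<mu> (\<lambda>k \<omega>. \<omega> (\<psi> k)) X)"

end

theory Submission
  imports Defs
begin

text \<open>Passing to the \<open>L\<^sup>2\<close>-limit, \<open>\<Sum>i. t i * X i\<close> has the characteristic function
  \<open>E\<^sub>\<beta> (- (\<Sum>i. (t i)\<^sup>2) / 2)\<close>. For \<open>\<beta> = 1\<close> this is a product of Gaussian factors, so the \<open>X i\<close> are
  independent. Conversely, independence of two of them gives \<open>E\<^sub>\<beta> (2 x) = (E\<^sub>\<beta> x)\<^sup>2\<close> for \<open>x < 0\<close>;
  comparing the coefficients of \<open>x\<^sup>2\<close> yields \<open>\<Gamma> (2 \<beta> + 1) = 2 \<Gamma> (\<beta> + 1)\<^sup>2\<close>, which fails for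
  \<open>0 < \<beta> < 1\<close> because \<open>ln \<Gamma> (2 x + 1) - 2 ln \<Gamma> (x + 1)\<close> is strictly increasing (its derivative
  is a difference of digamma values) and equals \<open>ln 2\<close> at \<open>x = 1\<close>.\<close>

section \<open>The Mittag-Leffler function on the real line\<close>

text \<open>On the window from \<open>T\<close> to \<open>T + 1\<close> the integrand of the Gamma
  integral is at least \<open>T powr y * exp (- (T + 1))\<close>, and the rest of the integral is
  nonnegative. Since \<open>T\<close> is free, Gamma outgrows every geometric sequence, which is all
  that convergence of the Mittag-Leffler series needs.\<close>

lemma Gamma_plus1_ge_powr:
  fixes y T :: real
  assumes "0 \<le> y" "0 < T"
  shows "T powr y * exp (- (T + 1)) \<le> Gamma (y + 1)"
proof -
  have G: "((\<lambda>t. t powr y / exp t) has_integral Gamma (y + 1)) {0..}"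
    using Gamma_integral_real[of "y + 1"] assms by simp
  have "((\<lambda>t. T powr y * exp (- (T + 1))) has_integral T powr y * exp (- (T + 1))) {T..T + 1}"
    using has_integral_const_real[of "T powr y * exp (- (T + 1))" T "T + 1"] by simp
  moreover have int: "(\<lambda>t. t powr y / exp t) integrable_on {T..T + 1}"
    using assms by (intro integrable_continuous_real continuous_intros) auto
  ultimately have "T powr y * exp (- (T + 1)) \<le> integral {T..T + 1} (\<lambda>t. t powr y / exp t)"
  proof (rule has_integral_le[OF _ integrable_integral])
    fix t assume "t \<in> {T..T + 1}"
    then have "T powr y * exp (- (T + 1)) \<le> t powr y * exp (- t)"
      using assms by (intro mult_mono powr_mono2) auto
    then show "T powr y * exp (- (T + 1)) \<le> t powr y / exp t"
      by (simp add: exp_minus field_simps)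
  qed
  also have "\<dots> \<le> Gamma (y + 1)"
    using assms by (intro has_integral_subset_le[OF _ integrable_integral[OF int] G]) auto
  finally show ?thesis .
qed

lemma summable_mittag_leffler:
  fixes x :: real
  assumes "0 < \<beta>"
  shows "summable (\<lambda>n. 1 / Gamma (\<beta> * real n + 1) * x ^ n)"
proof -
  \<comment> \<open>With this \<open>T\<close> the Gamma bound at
    \<open>y = \<beta> * real n\<close> is a constant times
    \<open>(2 * \<bar>x\<bar> + 1) ^ n\<close>, so the series is dominated by a geometric one of
    ratio \<open>q < 1\<close>.\<close>
  define T where "T = (2 * \<bar>x\<bar> + 1) powr (1 / \<beta>)"
  have T: "0 < T" "T powr \<beta> = 2 * \<bar>x\<bar> + 1"
    using assms by (auto simp: T_def powr_powr)
  define q where "q = \<bar>x\<bar> / (2 * \<bar>x\<bar> + 1)"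
  have q: "norm q < 1" by (simp add: q_def divide_simps)
  show ?thesis
  proof (rule summable_comparison_test')
    show "summable (\<lambda>n. exp (T + 1) * q ^ n)"
      using q by (intro summable_mult summable_geometric)
  next
    fix n :: nat assume "n \<ge> 0"
    have "T powr (\<beta> * real n) = (2 * \<bar>x\<bar> + 1) ^ n"
      by (simp add: T(2) powr_realpow flip: powr_powr)
    then have ge: "(2 * \<bar>x\<bar> + 1) ^ n * exp (- (T + 1)) \<le> Gamma (\<beta> * real n + 1)"
      using Gamma_plus1_ge_powr[of "\<beta> * real n" T] assms T by simp
    have "norm (1 / Gamma (\<beta> * real n + 1) * x ^ n) = \<bar>x\<bar> ^ n / Gamma (\<beta> * real n + 1)"
      using assms by (simp add: abs_mult power_abs add_nonneg_pos)
    also have "\<dots> \<le> \<bar>x\<bar> ^ n / ((2 * \<bar>x\<bar> + 1) ^ n * exp (- (T + 1)))"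
      using ge by (intro divide_left_mono mult_pos_pos)
        (auto intro!: mult_pos_pos Gamma_real_pos simp: assms add_nonneg_pos less_imp_le)
    also have "\<dots> = exp (T + 1) * q ^ n"
      unfolding exp_minus by (simp add: q_def power_divide divide_simps)
    finally show "norm (1 / Gamma (\<beta> * real n + 1) * x ^ n) \<le> exp (T + 1) * q ^ n" .
  qed
qed

text \<open>Only real arguments occur in the characteristic functions. The summand is written as
  coefficient times power so that results on power series apply to it directly.\<close>

definition mittag_leffler_real :: "real \<Rightarrow> real \<Rightarrow> real" where
  "mittag_leffler_real \<beta> x = (\<Sum>n. 1 / Gamma (\<beta> * real n + 1) * x ^ n)"

lemma mittag_leffler_of_real:
  assumes "0 < \<beta>"
  shows "mittag_leffler \<beta> (of_real x) = of_real (mittag_leffler_real \<beta> x)"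
proof -
  have "(\<lambda>n. of_real (1 / Gamma (\<beta> * real n + 1) * x ^ n) :: complex)
          sums of_real (mittag_leffler_real \<beta> x)"
    unfolding mittag_leffler_real_def
    by (intro sums_of_real summable_sums summable_mittag_leffler assms)
  then show ?thesis
    by (simp add: mittag_leffler_def sums_iff)
qed

lemma isCont_mittag_leffler_real: "0 < \<beta> \<Longrightarrow> isCont (mittag_leffler_real \<beta>) x"
  unfolding mittag_leffler_real_def
  by (intro isCont_powser_converges_everywhere summable_mittag_leffler)

lemma mittag_leffler_real_1: "mittag_leffler_real 1 x = exp x"
proof -
  have "Gamma (real n + 1) = fact n" for n
    using Gamma_fact[of n, where 'a = real] by (simp add: add.commute)
  then show ?thesis
    by (simp add: mittag_leffler_real_def exp_def divide_inverse)
qed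

section \<open>Recovering \<beta> = 1 from the duplication identity\<close>

text \<open>The coefficients of x^2 in f(2x) and f(x)^2 are \<open>4 * a 2\<close> and
  \<open>2 * a 2 + (a 1)\<^sup>2\<close>; those of order 0 and 1 agree anyway. As the identity is
  given for negative arguments only, the coefficients are reached by dividing twice by x and letting
  x tend to 0 from the left.\<close>

lemma powser_duplication_coeffs:
  fixes a :: "nat \<Rightarrow> real"
  defines "f \<equiv> \<lambda>x. \<Sum>n. a n * x ^ n"
  assumes sum: "\<And>x. summable (\<lambda>n. a n * x ^ n)"
    and a0: "a 0 = 1"
    and dup: "\<And>x. x < 0 \<Longrightarrow> f (2 * x) = (f x)\<^sup>2"
  shows "2 * a 2 = (a 1)\<^sup>2"
proof -
  define p where "p = (\<lambda>x. \<Sum>n. a (Suc n) * x ^ n)"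
  define q where "q = (\<lambda>x. \<Sum>n. a (Suc (Suc n)) * x ^ n)"
  have sump: "summable (\<lambda>n. a (Suc n) * x ^ n)" for x
    using sum by (subst summable_powser_split_head)
  have sumq: "summable (\<lambda>n. a (Suc (Suc n)) * x ^ n)" for x
    using sump by (subst summable_powser_split_head)
  have f: "f x = 1 + p x * x" for x
    unfolding f_def p_def by (simp add: powser_split_head(1)[OF sum] a0)
  have p: "p x = a 1 + q x * x" for x
    unfolding p_def q_def by (subst powser_split_head(1)[OF sump]) simp
  have eq: "4 * q (2 * x) - 2 * q x = (p x)\<^sup>2" if x: "x < 0" for x
  proof -
    have "x * (2 * p (2 * x) - 2 * p x - x * (p x)\<^sup>2) = 0"
      using dup[OF x] by (simp add: f power2_eq_square algebra_simps)
    then have "2 * p (2 * x) - 2 * p x = x * (p x)\<^sup>2"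
      using x by simp
    \<comment> \<open>The constant \<open>a 1\<close> cancels in
      \<open>2 * p (2 * x) - 2 * p x\<close>, which leaves a second factor x to divide by.\<close>
    then have "x * (4 * q (2 * x) - 2 * q x - (p x)\<^sup>2) = 0"
      unfolding p[of "2 * x"] p[of x] by (simp add: algebra_simps)
    then show ?thesis using x by simp
  qed
  have cp: "isCont p x" and cq: "isCont q x" for x
    unfolding p_def q_def using sump sumq by (auto intro!: isCont_powser_converges_everywhere)
  have "((\<lambda>x. 4 * q (2 * x) - 2 * q x) \<longlongrightarrow> 4 * q (2 * 0) - 2 * q 0) (at_left 0)"
    using cq by (intro tendsto_intros isCont_tendsto_compose[of _ q] filterlim_at_within_not_equal) auto
  moreover have "((\<lambda>x. (p x)\<^sup>2) \<longlongrightarrow> (p 0)\<^sup>2) (at_left 0)"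
    using cp by (intro tendsto_intros isCont_tendsto_compose[of _ p]) auto
  moreover have "\<forall>\<^sub>F x in at_left 0. 4 * q (2 * x) - 2 * q x = (p x)\<^sup>2"
    by (auto simp: eventually_at_filter eq)
  ultimately have "4 * q (2 * 0) - 2 * q 0 = (p 0)\<^sup>2"
    by (intro tendsto_unique[OF trivial_limit_at_left_real Lim_transform_eventually])
  moreover have "p 0 = a 1" "q 0 = a 2"
    by (simp_all add: p_def q_def numeral_2_eq_2)
  ultimately show ?thesis by simp
qed

text \<open>Equality holds at x = 1, where Gamma(3) = 2 and Gamma(2) = 1. Strict growth of
  \<open>g\<close> up to that point gives the strict inequality to its left.\<close>

lemma Gamma_double_plus1_less:
  fixes x :: real
  assumes "0 < x" "x < 1"
  shows "Gamma (2 * x + 1) < 2 * (Gamma (x + 1))\<^sup>2"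
proof -
  define g where "g = (\<lambda>y::real. ln_Gamma (2 * y + 1) - 2 * ln_Gamma (y + 1))"
  have "g x < g 1"
  proof (rule DERIV_pos_imp_increasing[OF assms(2)])
    fix y :: real assume y: "x \<le> y" "y \<le> 1"
    have "(g has_real_derivative 2 * (Digamma (2 * y + 1) - Digamma (y + 1))) (at y)"
      unfolding g_def using y assms by (auto intro!: derivative_eq_intros)
    moreover have "Digamma (y + 1) < Digamma (2 * y + 1)"
      using y assms by (intro Digamma_real_strict_mono) auto
    ultimately show "\<exists>D. (g has_real_derivative D) (at y) \<and> 0 < D"
      by (intro exI conjI) auto
  qed
  also have "g 1 = ln 2"
    using ln_Gamma_real_conv_fact[of 2] ln_Gamma_real_conv_fact[of 3]
    by (simp add: g_def fact_numeral)
  finally have "ln_Gamma (2 * x + 1) < ln 2 + 2 * ln_Gamma (x + 1)"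
    by (simp add: g_def)
  then have "exp (ln_Gamma (2 * x + 1)) < exp (ln 2 + 2 * ln_Gamma (x + 1))"
    by simp
  also have "\<dots> = 2 * (exp (ln_Gamma (x + 1)))\<^sup>2"
    by (simp add: exp_add exp_double)
  finally show ?thesis
    using assms by (simp add: Gamma_real_pos_exp)
qed

lemma mittag_leffler_real_duplication:
  assumes "0 < \<beta>" "\<beta> \<le> 1"
    and "\<And>x. x < 0 \<Longrightarrow> mittag_leffler_real \<beta> (2 * x) = (mittag_leffler_real \<beta> x)\<^sup>2"
  shows "\<beta> = 1"
proof (rule ccontr)
  assume "\<beta> \<noteq> 1"
  then have less: "Gamma (2 * \<beta> + 1) < 2 * (Gamma (\<beta> + 1))\<^sup>2"
    using assms by (intro Gamma_double_plus1_less) auto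
  have "2 * (1 / Gamma (\<beta> * real 2 + 1)) = (1 / Gamma (\<beta> * real 1 + 1))\<^sup>2"
    using assms(3) summable_mittag_leffler[OF assms(1)]
    by (intro powser_duplication_coeffs) (auto simp: mittag_leffler_real_def Gamma_1)
  then have "2 / Gamma (2 * \<beta> + 1) = 1 / (Gamma (\<beta> + 1))\<^sup>2"
    by (simp add: power_divide mult.commute)
  moreover have "0 < Gamma (\<beta> + 1)" "0 < Gamma (2 * \<beta> + 1)"
    using assms by (auto intro!: Gamma_real_pos)
  ultimately have "2 * (Gamma (\<beta> + 1))\<^sup>2 = Gamma (2 * \<beta> + 1)"
    by (simp add: divide_simps)
  with less show False by simp
qed

section \<open>Independence from characteristic functions\<close>

lemma char_distr: "X \<in> borel_measurable M \<Longrightarrow> char (distr M borel X) t = (CLINT \<omega>|M. iexp (t * X \<omega>))"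
  by (simp add: char_def integral_distr)

context prob_space
begin

text \<open>Tilting the measure by the density \<open>(2 + W) / c\<close>, with \<open>c\<close> its total mass, leaves the
  characteristic function of \<open>X\<close> unchanged, hence by uniqueness its distribution.\<close>

lemma expectation_mult_indicator_of_char:
  fixes W X :: "'a \<Rightarrow> real"
  assumes [measurable]: "random_variable borel W" "random_variable borel X" "A \<in> sets borel"
    and W: "\<And>\<omega>. \<bar>W \<omega>\<bar> \<le> 1"
    and char: "\<And>t. (CLINT \<omega>|M. W \<omega> *\<^sub>R iexp (t * X \<omega>)) = expectation W *\<^sub>R (CLINT \<omega>|M. iexp (t * X \<omega>))"
  shows "expectation (\<lambda>\<omega>. W \<omega> * indicator A (X \<omega>)) = expectation W * expectation (\<lambda>\<omega>. indicator A (X \<omega>))"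
proof -
  have iW[simp]: "integrable M W"
    by (rule integrable_const_bound[of _ 1]) (auto simp: W)
  \<comment> \<open>The summand 2 keeps the density positive: as \<open>W\<close> is at least -1,
    \<open>2 + W\<close> and its mean \<open>c\<close> are at least 1, whatever the sign of
    \<open>expectation W\<close>.\<close>
  define c where "c = 2 + expectation W"
  have "expectation (\<lambda>\<omega>. - 1) \<le> expectation W"
    using W by (intro integral_mono) (auto simp: abs_le_iff minus_le_iff)
  then have c: "0 < c" by (simp add: c_def prob_space)
  define D where "D = (\<lambda>\<omega>. (2 + W \<omega>) / c)"
  have D[measurable]: "D \<in> borel_measurable M" by (simp add: D_def)
  have "- 1 \<le> W \<omega>" for \<omega> using W[of \<omega>] by linarith
  then have D0: "0 \<le> D \<omega>" for \<omega>
    using c by (simp add: D_def) (smt (verit) divide_nonneg_pos)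
  have iD: "integrable M D" by (simp add: D_def)
  have eD: "expectation D = 1"
    using c by (simp add: D_def prob_space) (simp add: c_def)
  define N where "N = density M D"
  have "emeasure N (space N) = ennreal (expectation D)"
    unfolding N_def using D0 iD
    by (simp add: emeasure_density nn_integral_eq_integral flip: nn_integral_set_ennreal cong: nn_integral_cong_simp)
  then interpret N: prob_space N
    by (intro prob_spaceI) (simp add: eD)
  have [measurable]: "X \<in> borel_measurable N" by (simp add: N_def)
  interpret X: real_distribution "distr M borel X"
    by (rule real_distribution_distr) simp
  interpret NX: real_distribution "distr N borel X"
    by (rule N.real_distribution_distr) simp
  have distr_eq: "distr N borel X = distr M borel X"
  proof (rule Levy_uniqueness)
    show "char (distr N borel X) = char (distr M borel X)"
    proof
      fix t
      have i: "integrable M (\<lambda>\<omega>. iexp (t * X \<omega>))"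
        by (rule integrable_const_bound[of _ 1]) auto
      have iw: "integrable M (\<lambda>\<omega>. W \<omega> *\<^sub>R iexp (t * X \<omega>))"
        using W by (intro integrable_const_bound[of _ 1]) auto
      have "char (distr N borel X) t = (CLINT \<omega>|M. D \<omega> *\<^sub>R iexp (t * X \<omega>))"
        by (simp add: char_distr) (simp add: N_def integral_density D0)
      also have "\<dots> = (CLINT \<omega>|M. (1 / c) *\<^sub>R (2 *\<^sub>R iexp (t * X \<omega>) + W \<omega> *\<^sub>R iexp (t * X \<omega>)))"
        by (simp only: D_def scaleR_add_left[symmetric] scaleR_scaleR) simp
      \<comment> \<open>By the hypothesis on characteristic functions, the \<open>W\<close> term is
        \<open>expectation W\<close> times the untilted characteristic function. The two terms
        together thus carry the factor \<open>2 + expectation W = c\<close>, which cancels the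
        normalisation.\<close>
      also have "\<dots> = (1 / c) *\<^sub>R (2 *\<^sub>R (CLINT \<omega>|M. iexp (t * X \<omega>)) + expectation W *\<^sub>R (CLINT \<omega>|M. iexp (t * X \<omega>)))"
        unfolding char[symmetric] using i iw
        by (subst integral_scaleR_right) (auto simp del: of_real_mult scaleR_conv_of_real)
      also have "\<dots> = (1 / c * c) *\<^sub>R (CLINT \<omega>|M. iexp (t * X \<omega>))"
        unfolding c_def scaleR_add_left scaleR_scaleR[symmetric] ..
      also have "\<dots> = char (distr M borel X) t"
        using c by (simp add: char_distr)
      finally show "char (distr N borel X) t = char (distr M borel X) t" .
    qed
  qed unfold_locales
  \<comment> \<open>The equality of distributions is now tested on \<open>A\<close>. After
    \<open>D\<close> is expanded, the contribution of the summand 2 cancels and the claim about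
    \<open>W\<close> remains.\<close>
  have "expectation (\<lambda>\<omega>. D \<omega> * indicator A (X \<omega>)) = (\<integral>\<omega>. indicator A (X \<omega>) \<partial>N)"
    by (simp add: N_def integral_density D0)
  also have "\<dots> = (\<integral>x. indicator A x \<partial>distr N borel X)"
    by (subst integral_distr) simp_all
  also have "\<dots> = expectation (\<lambda>\<omega>. indicator A (X \<omega>))"
    unfolding distr_eq by (subst integral_distr) simp_all
  finally have "expectation (\<lambda>\<omega>. D \<omega> * indicator A (X \<omega>)) = expectation (\<lambda>\<omega>. indicator A (X \<omega>))" .
  moreover have iA: "integrable M (\<lambda>\<omega>. indicator A (X \<omega>) :: real)"
    by (rule integrable_const_bound[of _ 1]) (auto simp: indicator_def)
  have iWA: "integrable M (\<lambda>\<omega>. W \<omega> * indicator A (X \<omega>))"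
    by (rule integrable_const_bound[of _ 1]) (auto simp: indicator_def W)
  have "expectation (\<lambda>\<omega>. D \<omega> * indicator A (X \<omega>))
      = expectation (\<lambda>\<omega>. (1 / c) * (2 * indicator A (X \<omega>) + W \<omega> * indicator A (X \<omega>)))"
    by (simp add: D_def field_simps)
  also have "\<dots> = (1 / c) * (2 * expectation (\<lambda>\<omega>. indicator A (X \<omega>)) + expectation (\<lambda>\<omega>. W \<omega> * indicator A (X \<omega>)))"
    using iA iWA by (subst integral_mult_right_zero) simp
  ultimately have "2 * expectation (\<lambda>\<omega>. indicator A (X \<omega>)) + expectation (\<lambda>\<omega>. W \<omega> * indicator A (X \<omega>))
     = c * expectation (\<lambda>\<omega>. indicator A (X \<omega>))"
    using c by (simp add: field_simps)
  then show ?thesis by (simp add: c_def algebra_simps)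
qed

text \<open>A density must be real, so the real version is applied to \<open>Re (Z \<omega>)\<close>
  and \<open>Im (Z \<omega>)\<close>. Both are linear combinations of \<open>Z\<close> and its
  conjugate, and the hypothesis passes to the conjugate by conjugating it at
  \<open>- t\<close>.\<close>

lemma complex_expectation_mult_indicator_of_char:
  fixes Z :: "'a \<Rightarrow> complex" and X :: "'a \<Rightarrow> real"
  assumes [measurable]: "random_variable borel Z" "random_variable borel X" "A \<in> sets borel"
    and Z: "\<And>\<omega>. cmod (Z \<omega>) \<le> 1"
    and char: "\<And>t. (CLINT \<omega>|M. Z \<omega> * iexp (t * X \<omega>)) = (CLINT \<omega>|M. Z \<omega>) * (CLINT \<omega>|M. iexp (t * X \<omega>))"
  shows "(CLINT \<omega>|M. Z \<omega> * indicator A (X \<omega>)) = (CLINT \<omega>|M. Z \<omega>) * (CLINT \<omega>|M. indicator A (X \<omega>))"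
proof -
  have iZ: "integrable M Z"
    by (rule integrable_const_bound[of _ 1]) (auto simp: Z)
  have iZe: "integrable M (\<lambda>\<omega>. Z \<omega> * iexp (t * X \<omega>))" for t
    by (rule integrable_const_bound[of _ 1]) (auto simp: Z norm_mult)
  have iZA: "integrable M (\<lambda>\<omega>. Z \<omega> * indicator A (X \<omega>))"
    by (rule integrable_const_bound[of _ 1]) (auto simp: Z norm_mult indicator_def)
  have eA: "(CLINT \<omega>|M. indicator A (X \<omega>)) = complex_of_real (expectation (\<lambda>\<omega>. indicator A (X \<omega>)))"
    unfolding integral_complex_of_real[symmetric]
    by (rule Bochner_Integration.integral_cong) (auto simp: indicator_def)
  have cnj: "(CLINT \<omega>|M. cnj (Z \<omega>) * iexp (t * X \<omega>)) = cnj (CLINT \<omega>|M. Z \<omega>) * (CLINT \<omega>|M. iexp (t * X \<omega>))" for t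
  proof -
    have "(CLINT \<omega>|M. cnj (Z \<omega>) * iexp (t * X \<omega>)) = (CLINT \<omega>|M. cnj (Z \<omega> * iexp (- t * X \<omega>)))"
      by (simp add: exp_cnj)
    also have "\<dots> = cnj (CLINT \<omega>|M. Z \<omega> * iexp (- t * X \<omega>))"
      by (rule Bochner_Integration.integral_cnj)
    also have "\<dots> = cnj (CLINT \<omega>|M. Z \<omega>) * cnj (CLINT \<omega>|M. iexp (- t * X \<omega>))"
      by (simp only: char complex_cnj_mult)
    also have "cnj (CLINT \<omega>|M. iexp (- t * X \<omega>)) = (CLINT \<omega>|M. cnj (iexp (- t * X \<omega>)))"
      by (rule Bochner_Integration.integral_cnj[symmetric])
    finally show ?thesis by (simp add: exp_cnj)
  qed
  have ReIm: "of_real (Re z) = (z + cnj z) / 2" "of_real (Im z) = (z - cnj z) / (2 * \<i>)" for z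
    by (simp_all add: complex_eq_iff Re_divide Im_divide)
  have iCe: "integrable M (\<lambda>\<omega>. cnj (Z \<omega>) * iexp (t * X \<omega>))" for t
    using integrable_cnj[OF iZe[of "- t"]] by (simp add: exp_cnj)
  have Re: "expectation (\<lambda>\<omega>. Re (Z \<omega>) * indicator A (X \<omega>)) = expectation (\<lambda>\<omega>. Re (Z \<omega>)) * expectation (\<lambda>\<omega>. indicator A (X \<omega>))"
  proof (rule expectation_mult_indicator_of_char)
    show "\<bar>Re (Z \<omega>)\<bar> \<le> 1" for \<omega> using abs_Re_le_cmod[of "Z \<omega>"] Z[of \<omega>] by linarith
    fix t
    have "(CLINT \<omega>|M. Re (Z \<omega>) *\<^sub>R iexp (t * X \<omega>)) = (CLINT \<omega>|M. (Z \<omega> * iexp (t * X \<omega>) + cnj (Z \<omega>) * iexp (t * X \<omega>)) / 2)"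
      by (simp add: scaleR_conv_of_real ReIm algebra_simps del: of_real_mult)
    also have "\<dots> = (((CLINT \<omega>|M. Z \<omega>) + cnj (CLINT \<omega>|M. Z \<omega>)) / 2) * (CLINT \<omega>|M. iexp (t * X \<omega>))"
      using iZe iCe by (simp add: char cnj algebra_simps add_divide_distrib del: of_real_mult)
    also have "((CLINT \<omega>|M. Z \<omega>) + cnj (CLINT \<omega>|M. Z \<omega>)) / 2 = of_real (expectation (\<lambda>\<omega>. Re (Z \<omega>)))"
      using iZ by (simp add: integral_Re flip: ReIm)
    finally show "(CLINT \<omega>|M. Re (Z \<omega>) *\<^sub>R iexp (t * X \<omega>)) = expectation (\<lambda>\<omega>. Re (Z \<omega>)) *\<^sub>R (CLINT \<omega>|M. iexp (t * X \<omega>))"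
      by (simp add: scaleR_conv_of_real)
  qed simp_all
  have Im: "expectation (\<lambda>\<omega>. Im (Z \<omega>) * indicator A (X \<omega>)) = expectation (\<lambda>\<omega>. Im (Z \<omega>)) * expectation (\<lambda>\<omega>. indicator A (X \<omega>))"
  proof (rule expectation_mult_indicator_of_char)
    show "\<bar>Im (Z \<omega>)\<bar> \<le> 1" for \<omega> using abs_Im_le_cmod[of "Z \<omega>"] Z[of \<omega>] by linarith
    fix t
    have "(CLINT \<omega>|M. Im (Z \<omega>) *\<^sub>R iexp (t * X \<omega>)) = (CLINT \<omega>|M. (Z \<omega> * iexp (t * X \<omega>) - cnj (Z \<omega>) * iexp (t * X \<omega>)) / (2 * \<i>))"
      by (simp only: scaleR_conv_of_real ReIm left_diff_distrib times_divide_eq_left)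
    also have "\<dots> = (((CLINT \<omega>|M. Z \<omega>) - cnj (CLINT \<omega>|M. Z \<omega>)) / (2 * \<i>)) * (CLINT \<omega>|M. iexp (t * X \<omega>))"
      unfolding integral_divide_zero Bochner_Integration.integral_diff[OF iZe iCe] char cnj
      by (simp only: left_diff_distrib times_divide_eq_left)
    also have "((CLINT \<omega>|M. Z \<omega>) - cnj (CLINT \<omega>|M. Z \<omega>)) / (2 * \<i>) = of_real (expectation (\<lambda>\<omega>. Im (Z \<omega>)))"
      by (simp only: ReIm(2) integral_Im[OF iZ])
    finally show "(CLINT \<omega>|M. Im (Z \<omega>) *\<^sub>R iexp (t * X \<omega>)) = expectation (\<lambda>\<omega>. Im (Z \<omega>)) *\<^sub>R (CLINT \<omega>|M. iexp (t * X \<omega>))"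
      by (simp add: scaleR_conv_of_real)
  qed simp_all
  have ind: "Re (indicator A x) = indicator A x" "Im (indicator A x) = 0" for x :: real
    by (simp_all add: indicator_def)
  \<comment> \<open>By \<open>eA\<close> the expectation of the indicator is real, so multiplication
    by it acts separately on real and imaginary parts.\<close>
  show ?thesis
    unfolding eA using Re Im iZ iZA
    by (simp add: complex_eq_iff ind flip: integral_Re integral_Im)
qed

text \<open>Kac's criterion. Uniqueness for characteristic functions is used only in dimension one,
  on one coordinate at a time, while all other factors are absorbed into a bounded weight.\<close>

lemma indep_vars_of_char:
  fixes X :: "'i \<Rightarrow> 'a \<Rightarrow> real"
  assumes fin: "finite I"
    and rv: "\<And>i. i \<in> I \<Longrightarrow> random_variable borel (X i)"
    and char: "\<And>t. (CLINT \<omega>|M. \<Prod>i\<in>I. iexp (t i * X i \<omega>)) = (\<Prod>i\<in>I. CLINT \<omega>|M. iexp (t i * X i \<omega>))"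
  shows "indep_vars (\<lambda>_. borel) X I"
proof -
  text \<open>The exponentials are traded for indicator functions one index at a time.\<close>
  have mixed: "(CLINT \<omega>|M. \<Prod>i\<in>I. g i (X i \<omega>)) = (\<Prod>i\<in>I. CLINT \<omega>|M. g i (X i \<omega>))"
    if "finite S" "S \<subseteq> I" "\<And>i. i \<in> S \<Longrightarrow> \<exists>A\<in>sets borel. g i = indicator A"
      "\<And>i. i \<in> I - S \<Longrightarrow> \<exists>t. g i = (\<lambda>x. iexp (t * x))"
    for S and g :: "'i \<Rightarrow> real \<Rightarrow> complex"
    using that
  proof (induction S arbitrary: g)
    case empty
    then have "\<forall>i\<in>I. \<exists>t. g i = (\<lambda>x. iexp (t * x))" by simp
    then obtain t where "\<forall>i\<in>I. g i = (\<lambda>x. iexp (t i * x))" by metis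
    then show ?case using char[of t] by (simp cong: prod.cong)
  next
    case (insert m S)
    from insert.prems insert.hyps have m: "m \<in> I" "m \<notin> S" by auto
    have g: "g i \<in> borel_measurable borel \<and> (\<forall>x. cmod (g i x) \<le> 1)" if "i \<in> I" for i
    proof (cases "i \<in> insert m S")
      case True
      with insert.prems(2) obtain A where "A \<in> sets borel" "g i = indicator A" by blast
      then show ?thesis by (auto simp: indicator_def intro!: borel_measurable_indicator)
    next
      case False
      with insert.prems(3) that obtain t where "g i = (\<lambda>x. iexp (t * x))" by blast
      then show ?thesis by (auto simp flip: of_real_mult)
    qed
    from insert.prems obtain A where A: "A \<in> sets borel" "g m = indicator A" by blast
    define Z where "Z = (\<lambda>\<omega>. \<Prod>i\<in>I-{m}. g i (X i \<omega>))"
    have split: "(\<Prod>i\<in>I. h i) = (\<Prod>i\<in>I-{m}. h i) * h m" for h :: "'i \<Rightarrow> complex"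
      using prod.remove[OF fin m(1), of h] by (simp add: mult.commute)
    have mZ: "random_variable borel Z"
      unfolding Z_def using g rv by (intro borel_measurable_prod) (blast intro: measurable_compose)
    have Z1: "cmod (Z \<omega>) \<le> 1" for \<omega>
      unfolding Z_def prod_norm[symmetric] using g by (intro prod_le_1) auto
    have step: "(CLINT \<omega>|M. Z \<omega> * iexp (t * X m \<omega>)) = (\<Prod>i\<in>I-{m}. CLINT \<omega>|M. g i (X i \<omega>)) * (CLINT \<omega>|M. iexp (t * X m \<omega>))" for t
    proof -
      \<comment> \<open>With an exponential put back at index \<open>m\<close>, the induction
        hypothesis for \<open>S\<close> applies. Letting \<open>t\<close> vary supplies the
        factorisation needed to exchange that exponential for an indicator.\<close>
      let ?g = "g(m := (\<lambda>x. iexp (t * x)))"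
      have "(CLINT \<omega>|M. \<Prod>i\<in>I. ?g i (X i \<omega>)) = (\<Prod>i\<in>I. CLINT \<omega>|M. ?g i (X i \<omega>))"
      proof (rule insert.IH)
        show "\<exists>A\<in>sets borel. ?g i = indicator A" if "i \<in> S" for i
          using insert.prems(2)[of i] that m by auto
        show "\<exists>t. ?g i = (\<lambda>x. iexp (t * x))" if "i \<in> I - S" for i
          using insert.prems(3)[of i] that by (cases "i = m") auto
      qed (use insert.prems in auto)
      moreover have "(\<Prod>i\<in>I-{m}. ?g i (X i \<omega>)) = Z \<omega>" for \<omega>
        unfolding Z_def by (intro prod.cong) auto
      moreover have "(\<Prod>i\<in>I-{m}. CLINT \<omega>|M. ?g i (X i \<omega>)) = (\<Prod>i\<in>I-{m}. CLINT \<omega>|M. g i (X i \<omega>))"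
        by (intro prod.cong) auto
      ultimately show ?thesis
        unfolding split by simp
    qed
    \<comment> \<open>At \<open>t = 0\<close> the exponential is 1, which identifies the expectation
      of \<open>Z\<close> itself.\<close>
    have Z: "(CLINT \<omega>|M. Z \<omega>) = (\<Prod>i\<in>I-{m}. CLINT \<omega>|M. g i (X i \<omega>))"
      using step[of 0] by (simp add: prob_space)
    have "(CLINT \<omega>|M. Z \<omega> * indicator A (X m \<omega>)) = (CLINT \<omega>|M. Z \<omega>) * (CLINT \<omega>|M. indicator A (X m \<omega>))"
      by (intro complex_expectation_mult_indicator_of_char mZ rv m A Z1) (simp only: step Z)
    then show ?case
      unfolding split Z by (simp add: Z_def A)
  qed
  have ind: "prob (\<Inter>i\<in>J. X i -` A i \<inter> space M) = (\<Prod>i\<in>J. prob (X i -` A i \<inter> space M))"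
    if J: "J \<subseteq> I" "J \<noteq> {}" and A: "\<And>i. i \<in> J \<Longrightarrow> A i \<in> sets borel" for J A
  proof -
    \<comment> \<open>Padding with \<open>UNIV\<close> outside \<open>J\<close> contributes factors
      1, so \<open>mixed\<close> can be used on all of \<open>I\<close> with every index already
      exchanged.\<close>
    define B where "B i = (if i \<in> J then A i else UNIV)" for i
    have B: "B i \<in> sets borel" for i using A by (auto simp: B_def)
    have finJ: "finite J" using J fin finite_subset by blast
    have e: "(CLINT \<omega>|M. indicator C (Y \<omega>)) = of_real (prob (Y -` C \<inter> space M))"
      if "C \<in> sets borel" "random_variable borel Y" for C and Y :: "'a \<Rightarrow> real"
    proof -
      have "(CLINT \<omega>|M. indicator C (Y \<omega>)) = (CLINT \<omega>|M. of_real (indicator (Y -` C \<inter> space M) \<omega>))"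
        by (intro Bochner_Integration.integral_cong) (auto simp: indicator_def)
      also have "\<dots> = of_real (prob (Y -` C \<inter> space M))"
        using that by (simp add: measurable_sets)
      finally show ?thesis .
    qed
    let ?E = "\<Inter>i\<in>J. X i -` A i \<inter> space M"
    have E: "?E \<in> events"
      using J finJ A rv by (intro sets.finite_INT measurable_sets[of _ _ borel]) auto
    have "(\<Prod>i\<in>I. indicator (B i) (X i \<omega>)) = (complex_of_real (indicator ?E \<omega>))" if "\<omega> \<in> space M" for \<omega>
    proof (cases "\<omega> \<in> ?E")
      case True
      then show ?thesis using J(2) by (auto simp: B_def intro!: prod.neutral)
    next
      case False
      with that J(2) obtain i where "i \<in> J" "X i \<omega> \<notin> A i" by auto
      then show ?thesis using J fin False by (auto simp: B_def intro!: prod_zero bexI[of _ i])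
    qed
    then have "(CLINT \<omega>|M. \<Prod>i\<in>I. indicator (B i) (X i \<omega>)) = (CLINT \<omega>|M. of_real (indicator ?E \<omega>))"
      by (intro Bochner_Integration.integral_cong) auto
    also have "\<dots> = complex_of_real (prob ?E)"
      using E by simp
    finally have "of_real (prob ?E) = (CLINT \<omega>|M. \<Prod>i\<in>I. indicator (B i) (X i \<omega>))" ..
    also have "\<dots> = (\<Prod>i\<in>I. CLINT \<omega>|M. indicator (B i) (X i \<omega>))"
      using B fin by (intro mixed[of I]) auto
    also have "\<dots> = (\<Prod>i\<in>I. of_real (prob (X i -` B i \<inter> space M)))"
      using B rv by (intro prod.cong e) auto
    also have "\<dots> = (\<Prod>i\<in>J. of_real (prob (X i -` B i \<inter> space M)))"
      using J fin by (intro prod.mono_neutral_right) (auto simp: B_def prob_space)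
    also have "\<dots> = complex_of_real (\<Prod>i\<in>J. prob (X i -` A i \<inter> space M))"
      by (simp add: B_def cong: prod.cong)
    finally show ?thesis by (simp only: of_real_eq_iff)
  qed
  show ?thesis
    unfolding indep_vars_def2
  proof (intro conjI ballI rv indep_setsI)
    fix A J assume J: "J \<noteq> {}" "J \<subseteq> I" "finite J"
      and "\<forall>j\<in>J. A j \<in> {X j -` A \<inter> space M |A. A \<in> sets borel}"
    then have "\<forall>j\<in>J. \<exists>B\<in>sets borel. A j = X j -` B \<inter> space M" by blast
    then obtain B where "\<forall>j\<in>J. B j \<in> sets borel \<and> A j = X j -` B j \<inter> space M" by metis
    then show "prob (\<Inter>j\<in>J. A j) = (\<Prod>j\<in>J. prob (A j))"
      using ind[OF J(2,1), of B] by (simp cong: prod.cong INF_cong)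
  next
    show "{X i -` A \<inter> space M |A. A \<in> sets borel} \<subseteq> events" if "i \<in> I" for i
      using rv[OF that] by (auto intro: measurable_sets)
  qed
qed

end

section \<open>Characteristic functions of \<open>L\<^sup>2\<close>-limits\<close>

text \<open>Factoring out the unimodular \<open>iexp b\<close> reduces this to the first-order
  Taylor bound at \<open>a - b\<close>. It turns mean-square closeness into closeness of
  characteristic functions.\<close>

lemma norm_iexp_diff_le: "cmod (iexp a - iexp b) \<le> \<bar>a - b\<bar>"
proof -
  have "iexp a - iexp b = iexp b * (iexp (a - b) - 1)"
    by (simp add: algebra_simps flip: exp_add)
  then show ?thesis
    using iexp_approx1[of "a - b" 0] by (simp add: norm_mult)
qed

lemma L2_limit_add:
  assumes f: "L2_limit M f X" and g: "L2_limit M g Y"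
    and [measurable]: "\<And>k. f k \<in> borel_measurable M" "\<And>k. g k \<in> borel_measurable M"
  shows "L2_limit M (\<lambda>k \<omega>. f k \<omega> + g k \<omega>) (\<lambda>\<omega>. X \<omega> + Y \<omega>)"
proof -
  have [measurable]: "X \<in> borel_measurable M" "Y \<in> borel_measurable M"
    using f g by (auto simp: L2_limit_def)
  have sq: "(a + b)\<^sup>2 \<le> 2 * a\<^sup>2 + 2 * b\<^sup>2" for a b :: real
    using sum_squares_bound[of a b] by (simp add: power2_sum)
  have "integrable M (\<lambda>\<omega>. 2 * (X \<omega>)\<^sup>2 + 2 * (Y \<omega>)\<^sup>2)"
    using f g by (auto simp: L2_limit_def)
  then have int: "integrable M (\<lambda>\<omega>. (X \<omega> + Y \<omega>)\<^sup>2)"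
    by (rule Bochner_Integration.integrable_bound) (auto intro: order_trans[OF sq])
  define F where "F k = (\<integral>\<^sup>+ \<omega>. ennreal ((f k \<omega> - X \<omega>)\<^sup>2) \<partial>M)" for k
  define G where "G k = (\<integral>\<^sup>+ \<omega>. ennreal ((g k \<omega> - Y \<omega>)\<^sup>2) \<partial>M)" for k
  have "(\<lambda>k. 2 * F k + 2 * G k) \<longlonglongrightarrow> 2 * 0 + 2 * 0"
    using f g by (intro tendsto_add ennreal_tendsto_cmult) (auto simp: L2_limit_def F_def G_def)
  then have lim: "(\<lambda>k. 2 * F k + 2 * G k) \<longlonglongrightarrow> 0" by simp
  have le: "(\<integral>\<^sup>+ \<omega>. ennreal ((f k \<omega> + g k \<omega> - (X \<omega> + Y \<omega>))\<^sup>2) \<partial>M) \<le> 2 * F k + 2 * G k" for k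
  proof -
    have "ennreal ((f k \<omega> + g k \<omega> - (X \<omega> + Y \<omega>))\<^sup>2)
        \<le> 2 * ennreal ((f k \<omega> - X \<omega>)\<^sup>2) + 2 * ennreal ((g k \<omega> - Y \<omega>)\<^sup>2)" for \<omega>
      using sq[of "f k \<omega> - X \<omega>" "g k \<omega> - Y \<omega>"]
      by (simp add: algebra_simps ennreal_leI flip: ennreal_plus ennreal_mult' ennreal_numeral)
    then have "(\<integral>\<^sup>+ \<omega>. ennreal ((f k \<omega> + g k \<omega> - (X \<omega> + Y \<omega>))\<^sup>2) \<partial>M)
        \<le> (\<integral>\<^sup>+ \<omega>. 2 * ennreal ((f k \<omega> - X \<omega>)\<^sup>2) + 2 * ennreal ((g k \<omega> - Y \<omega>)\<^sup>2) \<partial>M)"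
      by (intro nn_integral_mono) auto
    also have "\<dots> = 2 * F k + 2 * G k"
      by (simp add: F_def G_def nn_integral_add nn_integral_cmult)
    finally show ?thesis .
  qed
  have "(\<lambda>k. \<integral>\<^sup>+ \<omega>. ennreal ((f k \<omega> + g k \<omega> - (X \<omega> + Y \<omega>))\<^sup>2) \<partial>M) \<longlonglongrightarrow> 0"
    by (rule tendsto_sandwich[OF _ _ tendsto_const lim]) (auto intro!: always_eventually le)
  with int show ?thesis by (simp add: L2_limit_def)
qed

lemma L2_limit_cmult:
  assumes f: "L2_limit M f X" and [measurable]: "\<And>k. f k \<in> borel_measurable M"
  shows "L2_limit M (\<lambda>k \<omega>. c * f k \<omega>) (\<lambda>\<omega>. c * X \<omega>)"
proof -
  have [measurable]: "X \<in> borel_measurable M"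
    using f by (auto simp: L2_limit_def)
  have "(\<integral>\<^sup>+ \<omega>. ennreal ((c * f k \<omega> - c * X \<omega>)\<^sup>2) \<partial>M)
      = ennreal (c\<^sup>2) * (\<integral>\<^sup>+ \<omega>. ennreal ((f k \<omega> - X \<omega>)\<^sup>2) \<partial>M)" for k
    by (simp add: power_mult_distrib ennreal_mult' nn_integral_cmult flip: right_diff_distrib)
  moreover have "(\<lambda>k. ennreal (c\<^sup>2) * (\<integral>\<^sup>+ \<omega>. ennreal ((f k \<omega> - X \<omega>)\<^sup>2) \<partial>M)) \<longlonglongrightarrow> ennreal (c\<^sup>2) * 0"
    using f by (intro ennreal_tendsto_cmult) (auto simp: L2_limit_def)
  ultimately show ?thesis
    using f by (simp add: L2_limit_def power_mult_distrib)
qed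

lemma L2_limit_sum:
  assumes "finite I" "\<And>i. i \<in> I \<Longrightarrow> L2_limit M (f i) (X i)"
    and "\<And>i k. i \<in> I \<Longrightarrow> f i k \<in> borel_measurable M"
  shows "L2_limit M (\<lambda>k \<omega>. \<Sum>i\<in>I. f i k \<omega>) (\<lambda>\<omega>. \<Sum>i\<in>I. X i \<omega>)"
  using assms
proof (induction I rule: finite_induct)
  case empty
  then show ?case by (simp add: L2_limit_def)
next
  case (insert i I)
  then show ?case by (simp add: L2_limit_add borel_measurable_sum)
qed

text \<open>By the Lipschitz bound and Cauchy-Schwarz, the squared distance of the two expectations
  is at most the squared L2 distance of \<open>f k\<close> and \<open>X\<close>.\<close>

lemma (in prob_space) L2_limit_char:
  assumes f: "L2_limit M f X" and [measurable]: "\<And>k. f k \<in> borel_measurable M"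
  shows "(\<lambda>k. CLINT \<omega>|M. iexp (f k \<omega>)) \<longlonglongrightarrow> (CLINT \<omega>|M. iexp (X \<omega>))"
proof -
  have [measurable]: "X \<in> borel_measurable M"
    using f by (auto simp: L2_limit_def)
  have i: "integrable M (\<lambda>\<omega>. iexp (Y \<omega>))" if "Y \<in> borel_measurable M" for Y
    using that by (intro integrable_const_bound[of _ 1]) auto
  define I where "I k = (\<integral>\<^sup>+ \<omega>. ennreal ((f k \<omega> - X \<omega>)\<^sup>2) \<partial>M)" for k
  have bound: "ennreal ((cmod ((CLINT \<omega>|M. iexp (f k \<omega>)) - (CLINT \<omega>|M. iexp (X \<omega>))))\<^sup>2) \<le> I k" for k
  proof -
    define h where "h \<omega> = cmod (iexp (f k \<omega>) - iexp (X \<omega>))" for \<omega>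
    have [measurable]: "h \<in> borel_measurable M" unfolding h_def by measurable
    have ih: "integrable M h"
      unfolding h_def by (intro integrable_norm Bochner_Integration.integrable_diff i) auto
    have h0: "0 \<le> h \<omega>" for \<omega> by (simp add: h_def)
    have "cmod ((CLINT \<omega>|M. iexp (f k \<omega>)) - (CLINT \<omega>|M. iexp (X \<omega>))) \<le> expectation h"
      unfolding h_def Bochner_Integration.integral_diff[OF i i, OF assms(2) \<open>X \<in> borel_measurable M\<close>, symmetric]
      by (rule integral_norm_bound)
    then have "ennreal ((cmod ((CLINT \<omega>|M. iexp (f k \<omega>)) - (CLINT \<omega>|M. iexp (X \<omega>))))\<^sup>2)
        \<le> ennreal ((expectation h)\<^sup>2)"
      by (intro ennreal_leI power_mono) auto
    also have "\<dots> = (ennreal (expectation h))\<^sup>2"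
      using h0 by (simp add: ennreal_power)
    \<comment> \<open>The factor 1 is the second function for Cauchy-Schwarz; its square integrates
      to 1 over a probability space.\<close>
    also have "ennreal (expectation h) = (\<integral>\<^sup>+ \<omega>. ennreal (h \<omega>) * 1 \<partial>M)"
      using ih h0 by (simp add: nn_integral_eq_integral)
    also have "(\<dots>)\<^sup>2 \<le> (\<integral>\<^sup>+ \<omega>. (ennreal (h \<omega>))\<^sup>2 \<partial>M) * (\<integral>\<^sup>+ \<omega>. 1\<^sup>2 \<partial>M)"
      by (rule Cauchy_Schwarz_nn_integral) auto
    also have "\<dots> = (\<integral>\<^sup>+ \<omega>. ennreal ((h \<omega>)\<^sup>2) \<partial>M)"
      using h0 by (simp add: ennreal_power emeasure_space_1)
    also have "\<dots> \<le> I k"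
      unfolding I_def h_def
      by (intro nn_integral_mono ennreal_leI) (metis abs_le_square_iff abs_norm_cancel norm_iexp_diff_le)
    finally show ?thesis .
  qed
  have "I \<longlonglongrightarrow> 0"
    using f unfolding L2_limit_def I_def by simp
  then have "(\<lambda>k. ennreal ((cmod ((CLINT \<omega>|M. iexp (f k \<omega>)) - (CLINT \<omega>|M. iexp (X \<omega>))))\<^sup>2)) \<longlonglongrightarrow> 0"
    by (intro tendsto_sandwich[OF _ _ tendsto_const[of 0] \<open>I \<longlonglongrightarrow> 0\<close>]) (auto simp: bound)
  then have "(\<lambda>k. (cmod ((CLINT \<omega>|M. iexp (f k \<omega>)) - (CLINT \<omega>|M. iexp (X \<omega>))))\<^sup>2) \<longlonglongrightarrow> 0"
    by (subst (asm) ennreal_tendsto_0_iff) auto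
  then show ?thesis
    by (simp add: tendsto_norm_zero_iff LIM_zero_iff)
qed

section \<open>Pairings with linear combinations of vectors of the Hilbert space\<close>

lemma nuclear_dual_sum:
  assumes N: "subspace (nuclear_space V)" and \<omega>: "\<omega> \<in> nuclear_dual V ip"
    and "finite I" "\<And>i. i \<in> I \<Longrightarrow> \<psi> i \<in> nuclear_space V"
  shows "\<omega> (\<Sum>i\<in>I. t i *\<^sub>R \<psi> i) = (\<Sum>i\<in>I. t i * \<omega> (\<psi> i))"
  using assms(3,4)
proof (induction I rule: finite_induct)
  case empty
  have "\<omega> (0 *\<^sub>R 0) = 0 * \<omega> 0"
    using \<omega> subspace_0[OF N] unfolding nuclear_dual_def by blast
  then show ?case by simp
next
  case (insert i I)
  \<comment> \<open>\<open>\<omega>\<close> is additive only on \<open>nuclear_space V\<close>, so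
    both summands must be placed there first.\<close>
  then have "t i *\<^sub>R \<psi> i \<in> nuclear_space V" "(\<Sum>i\<in>I. t i *\<^sub>R \<psi> i) \<in> nuclear_space V"
    using N by (auto intro!: subspace_scale subspace_sum)
  with insert \<omega> show ?case by (simp add: nuclear_dual_def)
qed

lemma (in nuclear_triple) subspace_nuclear_space: "subspace (nuclear_space V)"
proof -
  have "subspace (V p)" for p
    using hilbert[of p] by (auto simp: separable_hilbert_on_def intro: inner_product_on.subspace_carrier)
  then show ?thesis
    unfolding nuclear_space_def by (auto simp: subspace_def)
qed

lemma measurable_nuclear_pairing:
  assumes \<mu>: "is_mittag_leffler_measure V ip \<beta> \<mu>" and "\<psi> \<in> nuclear_space V"
  shows "(\<lambda>\<omega>. \<omega> \<psi>) \<in> borel_measurable \<mu>"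
proof (rule measurableI)
  have sp: "space \<mu> = nuclear_dual V ip"
    and se: "sets \<mu> = sigma_sets (nuclear_dual V ip) (cylinder_sets V ip)"
    using \<mu> by (auto simp: is_mittag_leffler_measure_def)
  fix A :: "real set" assume "A \<in> sets borel"
  \<comment> \<open>Cylinder bases are sets of functions on \<open>{..<k}\<close>; with
    \<open>k = 1\<close>, \<open>A\<close> becomes such a base by pulling it back along evaluation
    at 0.\<close>
  then have "(\<lambda>x. x 0) -` A \<inter> space (Pi\<^sub>M {..<1::nat} (\<lambda>_. borel)) \<in> sets (Pi\<^sub>M {..<1} (\<lambda>_. borel :: real measure))"
    by (intro measurable_sets[OF measurable_component_singleton]) auto
  then have "{\<omega> \<in> nuclear_dual V ip. (\<lambda>i\<in>{..<1::nat}. \<omega> ((\<lambda>_. \<psi>) i))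
      \<in> (\<lambda>x. x 0) -` A \<inter> space (Pi\<^sub>M {..<1} (\<lambda>_. borel))} \<in> cylinder_sets V ip"
    unfolding cylinder_sets_def mem_Collect_eq using assms(2) by (intro exI conjI refl) auto
  also have "{\<omega> \<in> nuclear_dual V ip. (\<lambda>i\<in>{..<1::nat}. \<omega> ((\<lambda>_. \<psi>) i))
      \<in> (\<lambda>x. x 0) -` A \<inter> space (Pi\<^sub>M {..<1} (\<lambda>_. borel))} = (\<lambda>\<omega>. \<omega> \<psi>) -` A \<inter> space \<mu>"
    by (auto simp: sp space_PiM)
  finally show "(\<lambda>\<omega>. \<omega> \<psi>) -` A \<inter> space \<mu> \<in> sets \<mu>"
    by (simp add: se)
qed simp

text \<open>Approximate each \<open>\<phi> i\<close> from the nuclear space. There a combination of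
  pairings is the pairing with the single vector \<open>S k\<close>, whose characteristic function
  is prescribed. The limit is taken by \<open>L2_limit_char\<close> on one side and by continuity of
  the Mittag-Leffler function on the other.\<close>

lemma char_sum_L2_pairing:
  fixes t :: "'i \<Rightarrow> real" and \<phi> :: "'i \<Rightarrow> 'h::{real_inner, banach}"
  assumes nt: "nuclear_triple V ip" and \<mu>: "is_mittag_leffler_measure V ip \<beta> \<mu>" and \<beta>: "0 < \<beta>"
    and I: "finite I" and X: "\<And>i. i \<in> I \<Longrightarrow> is_L2_pairing V \<mu> (\<phi> i) (X i)"
  defines "s \<equiv> \<Sum>i\<in>I. t i *\<^sub>R \<phi> i"
  shows "(CLINT \<omega>|\<mu>. iexp (\<Sum>i\<in>I. t i * X i \<omega>)) = of_real (mittag_leffler_real \<beta> (- (1/2) * inner s s))"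
proof -
  interpret prob_space \<mu> using \<mu> by (simp add: is_mittag_leffler_measure_def)
  have sp: "space \<mu> = nuclear_dual V ip"
    using \<mu> by (simp add: is_mittag_leffler_measure_def)
  note N = nuclear_triple.subspace_nuclear_space[OF nt]
  have "\<exists>\<psi>. (\<forall>k. \<psi> k \<in> nuclear_space V) \<and> \<psi> \<longlonglongrightarrow> \<phi> i" for i
    using nuclear_triple.dense[OF nt] closure_sequential[of "\<phi> i" "nuclear_space V"] by auto
  then obtain \<psi> where \<psi>: "\<And>i k. \<psi> i k \<in> nuclear_space V" "\<And>i. \<psi> i \<longlonglongrightarrow> \<phi> i" by metis
  note [measurable] = measurable_nuclear_pairing[OF \<mu> \<psi>(1)]
  define S where "S k = (\<Sum>i\<in>I. t i *\<^sub>R \<psi> i k)" for k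
  have S: "S k \<in> nuclear_space V" for k
    unfolding S_def using N \<psi>(1) by (intro subspace_sum subspace_scale)
  have "L2_limit \<mu> (\<lambda>k \<omega>. \<Sum>i\<in>I. t i * \<omega> (\<psi> i k)) (\<lambda>\<omega>. \<Sum>i\<in>I. t i * X i \<omega>)"
    using X \<psi> I by (intro L2_limit_sum L2_limit_cmult) (auto simp: is_L2_pairing_def)
  then have "(\<lambda>k. CLINT \<omega>|\<mu>. iexp (\<Sum>i\<in>I. t i * \<omega> (\<psi> i k))) \<longlonglongrightarrow> (CLINT \<omega>|\<mu>. iexp (\<Sum>i\<in>I. t i * X i \<omega>))"
    by (rule L2_limit_char) measurable
  moreover have "(CLINT \<omega>|\<mu>. iexp (\<Sum>i\<in>I. t i * \<omega> (\<psi> i k))) = of_real (mittag_leffler_real \<beta> (- (1/2) * inner (S k) (S k)))" for k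
  proof -
    have "(CLINT \<omega>|\<mu>. iexp (\<Sum>i\<in>I. t i * \<omega> (\<psi> i k))) = (CLINT \<omega>|\<mu>. iexp (\<omega> (S k)))"
      unfolding S_def
      by (intro Bochner_Integration.integral_cong refl)
        (simp only: sp nuclear_dual_sum[OF N _ I, where \<psi> = "\<lambda>i. \<psi> i k", OF _ \<psi>(1)])
    also have "\<dots> = mittag_leffler \<beta> (of_real (- (1/2) * inner (S k) (S k)))"
      using \<mu> S[of k] unfolding is_mittag_leffler_measure_def by blast
    finally show ?thesis by (simp only: mittag_leffler_of_real[OF \<beta>])
  qed
  moreover have "S \<longlonglongrightarrow> s"
    unfolding S_def s_def by (intro tendsto_intros \<psi>(2))
  then have "(\<lambda>k. complex_of_real (mittag_leffler_real \<beta> (- (1/2) * inner (S k) (S k))))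
      \<longlonglongrightarrow> of_real (mittag_leffler_real \<beta> (- (1/2) * inner s s))"
    by (intro tendsto_of_real isCont_tendsto_compose[OF isCont_mittag_leffler_real[OF \<beta>]] tendsto_intros)
  ultimately show ?thesis
    by (auto intro: LIMSEQ_unique)
qed

theorem proposition2p5:
  fixes V :: "nat \<Rightarrow> 'h::{real_inner, banach} set"
    and ip :: "nat \<Rightarrow> 'h \<Rightarrow> 'h \<Rightarrow> real"
    and \<beta> :: real
    and \<mu> :: "('h \<Rightarrow> real) measure"
    and n :: nat
    and \<phi> :: "nat \<Rightarrow> 'h"
    and X :: "nat \<Rightarrow> ('h \<Rightarrow> real) \<Rightarrow> real"
  assumes "0 < \<beta>" and "\<beta> \<le> 1"
    and "nuclear_triple V ip"
    and "is_mittag_leffler_measure V ip \<beta> \<mu>"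
    and "1 \<le> n"
    and "\<And>i j. i \<in> {1..n} \<Longrightarrow> j \<in> {1..n} \<Longrightarrow> inner (\<phi> i) (\<phi> j) = (if i = j then 1 else 0)"
    and "\<And>i. i \<in> {1..n} \<Longrightarrow> is_L2_pairing V \<mu> (\<phi> i) (X i)"
  shows "prob_space.indep_vars \<mu> (\<lambda>_. borel) X {1..n} \<longleftrightarrow> n = 1 \<or> \<beta> = 1"
proof -
  interpret prob_space \<mu> using assms(4) by (simp add: is_mittag_leffler_measure_def)
  let ?ml = "mittag_leffler_real \<beta>"
  \<comment> \<open>Orthonormality reduces the squared norm of the combination to the sum of the
    squared coefficients. A general \<open>J\<close> is allowed because singletons, a pair and the
    full index set all occur below.\<close>
  have char: "(CLINT \<omega>|\<mu>. iexp (\<Sum>i\<in>J. t i * X i \<omega>)) = of_real (?ml (- (1/2) * (\<Sum>i\<in>J. (t i)\<^sup>2)))"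
    if J: "J \<subseteq> {1..n}" for J t
  proof -
    have fin: "finite J" using J finite_subset by blast
    have "inner (\<Sum>i\<in>J. t i *\<^sub>R \<phi> i) (\<Sum>i\<in>J. t i *\<^sub>R \<phi> i)
        = (\<Sum>i\<in>J. \<Sum>j\<in>J. t i * t j * inner (\<phi> i) (\<phi> j))"
      by (simp add: inner_sum_left inner_sum_right sum_distrib_left mult_ac inner_commute)
    also have "\<dots> = (\<Sum>i\<in>J. \<Sum>j\<in>J. if i = j then t i * t j else 0)"
    proof (intro sum.cong refl)
      fix i j assume "i \<in> J" "j \<in> J"
      then show "t i * t j * inner (\<phi> i) (\<phi> j) = (if i = j then t i * t j else 0)"
        by (simp add: assms(6)[OF subsetD[OF J] subsetD[OF J]])
    qed
    also have "\<dots> = (\<Sum>i\<in>J. (t i)\<^sup>2)"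
      using fin by (simp add: power2_eq_square)
    finally show ?thesis
      using char_sum_L2_pairing[OF assms(3,4,1) fin assms(7)[OF subsetD[OF J]], where t = t] by simp
  qed
  \<comment> \<open>\<open>is_L2_pairing\<close> yields measurability only through an actual
    approximating sequence, which density provides.\<close>
  have rv: "random_variable borel (X i)" if i: "i \<in> {1..n}" for i
  proof -
    have "\<phi> i \<in> closure (nuclear_space V)"
      using nuclear_triple.dense[OF assms(3)] by simp
    then obtain \<psi> where "(\<forall>k. \<psi> k \<in> nuclear_space V) \<and> \<psi> \<longlonglongrightarrow> \<phi> i"
      unfolding closure_sequential by blast
    then have "L2_limit \<mu> (\<lambda>k \<omega>. \<omega> (\<psi> k)) (X i)"
      using assms(7)[OF i] unfolding is_L2_pairing_def by blast
    then show ?thesis by (simp add: L2_limit_def)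
  qed
  have char1: "(CLINT \<omega>|\<mu>. iexp (c * X i \<omega>)) = of_real (?ml (- (1/2) * c\<^sup>2))" if "i \<in> {1..n}" for i c
    using char[of "{i}" "\<lambda>_. c"] that by simp
  show ?thesis
  proof
    assume indep: "indep_vars (\<lambda>_. borel) X {1..n}"
    show "n = 1 \<or> \<beta> = 1"
    proof (rule disjCI)
      assume "\<beta> \<noteq> 1"
      show "n = 1"
      proof (rule ccontr)
        assume "n \<noteq> 1"
        with assms(5) have sub: "{1, 2} \<subseteq> {1..n}" by auto
        have "?ml (2 * x) = (?ml x)\<^sup>2" if "x < 0" for x
        proof -
          \<comment> \<open>Chosen so that - c^2 / 2 = x: at \<open>c\<close>, each single variable
            has characteristic function E(x), and the sum of two of them has E(2x).\<close>
          define c where "c = sqrt (- 2 * x)"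
          have c: "c\<^sup>2 = - 2 * x" using that by (simp add: c_def)
          have "of_real (?ml (2 * x)) = (CLINT \<omega>|\<mu>. iexp (\<Sum>i\<in>{1, 2}. c * X i \<omega>))"
            using char[OF sub, of "\<lambda>_. c"] by (simp add: c)
          also have "\<dots> = (CLINT \<omega>|\<mu>. iexp (c * (\<Sum>i\<in>{1, 2}. X i \<omega>)))"
            by (simp only: sum_distrib_left)
          also have "\<dots> = char (distr \<mu> borel (\<lambda>\<omega>. \<Sum>i\<in>{1, 2}. X i \<omega>)) c"
            using rv sub by (intro char_distr[symmetric] borel_measurable_sum) auto
          \<comment> \<open>Independence enters only here.\<close>
          also have "\<dots> = (\<Prod>i\<in>{1, 2}. char (distr \<mu> borel (X i)) c)"
            by (rule char_distr_sum[OF indep_vars_subset[OF indep sub]])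
          also have "\<dots> = (\<Prod>i\<in>{1::nat, 2}. of_real (?ml x))"
            using rv sub char1[of _ c] by (intro prod.cong) (auto simp: char_distr c simp del: of_real_mult)
          also have "\<dots> = of_real ((?ml x)\<^sup>2)"
            by (simp add: power2_eq_square)
          finally show ?thesis by (simp only: of_real_eq_iff)
        qed
        then have "\<beta> = 1"
          by (rule mittag_leffler_real_duplication[OF assms(1,2)])
        with \<open>\<beta> \<noteq> 1\<close> show False ..
      qed
    qed
  next
    assume *: "n = 1 \<or> \<beta> = 1"
    show "indep_vars (\<lambda>_. borel) X {1..n}"
    proof (rule indep_vars_of_char)
      fix t
      have exp: "(\<Prod>i\<in>{1..n}. iexp (t i * X i \<omega>)) = iexp (\<Sum>i\<in>{1..n}. t i * X i \<omega>)" for \<omega>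
        by (simp add: exp_sum sum_distrib_left)
      from * show "(CLINT \<omega>|\<mu>. \<Prod>i\<in>{1..n}. iexp (t i * X i \<omega>)) = (\<Prod>i\<in>{1..n}. CLINT \<omega>|\<mu>. iexp (t i * X i \<omega>))"
      proof
        assume "n = 1"
        then show ?thesis by simp
      next
        assume \<beta>: "\<beta> = 1"
        have "(\<Prod>i\<in>{1..n}. CLINT \<omega>|\<mu>. iexp (t i * X i \<omega>)) = (\<Prod>i\<in>{1..n}. of_real (exp (- (1/2) * (t i)\<^sup>2)))"
          using char1 \<beta> by (intro prod.cong) (simp_all add: mittag_leffler_real_1 del: of_real_mult)
        also have "\<dots> = of_real (exp (- (1/2) * (\<Sum>i\<in>{1..n}. (t i)\<^sup>2)))"
          by (simp add: exp_sum sum_distrib_left flip: of_real_prod)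
        finally show ?thesis
          unfolding exp char[OF order_refl] by (simp add: \<beta> mittag_leffler_real_1)
      qed
    qed (use rv in auto)
  qed
qed

end
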